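(* Let $n\geq 5$ and let $G$ be a nontrivial connected spanning convex subgraph of $C_n^2$. Then there exist integers $j,k$ with $0\leq j\leq n-1$ and $0\leq k\leq\lceil\frac{n-2}{2}\rceil$ such that $G=S_{n,k,j}$.
   Context: For $n\geq 5$, the square cycle $C_n^2$ has vertex set $\mathbb{Z}_n=\mathbb{Z}/n\mathbb{Z}$, with $v_i=i+n\mathbb{Z}$ for $i\in\mathbb{Z}$, and edge set $\{\{v_i,v_j\}: i-j\in\{1,2\}\}$. For $i\in\mathbb{Z}$ write $e_i=\{v_i,v_{i+1}\}$ (frames) and $f_i=\{v_i,v_{i+2}\}$ (windows), indices modulo $n$. A spanning subgraph has vertex set all of $\mathbb{Z}_n$. The triangles are $T_i=\{e_i,e_{i+1},f_i\}$; a subgraph $G$ is convex if for every $i$, either $|T_i\cap E(G)|\leq1$ or $T_i\subseteq E(G)$. The trivial connected spanning subgraphs are $C_n^2$ itself and, when $n$ is odd, the graph $(\mathbb{Z}_n,\{f_0,\dots,f_{n-1}\})$; "nontrivial" means not one of these. For integers $j,k$ with $0\leq k\leq\lceil\frac{n-2}{2}\rceil$, $S_{n,k,j}$ is the graph with vertex set $\mathbb{Z}_n$ and edge set $E(C_n^2)\setminus\big(\{f_j,f_{j+2k+1}\}\cup\{e_{j+1},\dots,e_{j+2k+1}\}\big)$. *)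

theory Defs
  imports Complex_Main
begin

text \<open>A simple graph is given by its vertex set and a set of unordered pairs of vertices.\<close>

record 'a ugraph =
  vertices :: "'a set"
  edges :: "'a set set"

definition simple_graph :: "'a ugraph \<Rightarrow> bool" where
  "simple_graph G \<longleftrightarrow> (\<forall>e\<in>edges G. e \<subseteq> vertices G \<and> card e = 2)"

definition subgraph :: "'a ugraph \<Rightarrow> 'a ugraph \<Rightarrow> bool" where
  "subgraph G H \<longleftrightarrow> simple_graph G \<and> vertices G \<subseteq> vertices H \<and> edges G \<subseteq> edges H"

definition spanning_subgraph :: "'a ugraph \<Rightarrow> 'a ugraph \<Rightarrow> bool" where
  "spanning_subgraph G H \<longleftrightarrow> subgraph G H \<and> vertices G = vertices H"

definition connected_graph :: "'a ugraph \<Rightarrow> bool" where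
  "connected_graph G \<longleftrightarrow> vertices G \<noteq> {} \<and>
     (\<forall>u\<in>vertices G. \<forall>w\<in>vertices G. (u, w) \<in> {(x, y). {x, y} \<in> edges G}\<^sup>*)"

text \<open>The residue class of \<open>i\<close> modulo \<open>n\<close> is represented by its least nonnegative element.\<close>

definition vtx :: "nat \<Rightarrow> int \<Rightarrow> int" where
  "vtx n i = i mod int n"

definition square_cycle :: "nat \<Rightarrow> int ugraph" where
  "square_cycle n =
     \<lparr>vertices = range (vtx n), edges = {{vtx n i, vtx n j} | i j. i - j \<in> {1, 2}}\<rparr>"

definition frame :: "nat \<Rightarrow> int \<Rightarrow> int set" where
  "frame n i = {vtx n i, vtx n (i + 1)}"

definition window :: "nat \<Rightarrow> int \<Rightarrow> int set" where
  "window n i = {vtx n i, vtx n (i + 2)}"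

text \<open>Triangles are identified with their edge sets.\<close>

definition triangle :: "nat \<Rightarrow> int \<Rightarrow> int set set" where
  "triangle n i = {frame n i, frame n (i + 1), window n i}"

definition convex_subgraph :: "nat \<Rightarrow> int ugraph \<Rightarrow> bool" where
  "convex_subgraph n G \<longleftrightarrow> subgraph G (square_cycle n) \<and>
     (\<forall>i. card (triangle n i \<inter> edges G) \<le> 1 \<or> triangle n i \<subseteq> edges G)"

definition window_graph :: "nat \<Rightarrow> int ugraph" where
  "window_graph n = \<lparr>vertices = range (vtx n), edges = window n ` {0..int n - 1}\<rparr>"

definition nontrivial :: "nat \<Rightarrow> int ugraph \<Rightarrow> bool" where
  "nontrivial n G \<longleftrightarrow> G \<noteq> square_cycle n \<and> \<not> (odd n \<and> G = window_graph n)"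

definition S_graph :: "nat \<Rightarrow> int \<Rightarrow> int \<Rightarrow> int ugraph" where
  "S_graph n k j =
     \<lparr>vertices = range (vtx n),
      edges = edges (square_cycle n) -
        ({window n j, window n (j + 2 * k + 1)} \<union> frame n ` {j + 1 .. j + 2 * k + 1})\<rparr>"

end

theory Submission
  imports Defs
begin

text \<open>By convexity two consecutive frames are both present or both absent if the window
  between them is present, and not both present otherwise. Hence an absent frame lies in an
  \<^emph>\<open>arc\<close>, a maximal run of absent frames bounded by two absent windows, with all windows strictly
  between them present. An arc of even length isolates every other vertex of the arc, and two
  disjoint arcs of odd length separate the graph into two parts. So a connected graph has exactly
  one arc, its length is odd, and everything outside the arc is present.\<close>

section \<open>Residues modulo \<open>n\<close> and their representatives in a period\<close>

lemma not_dvd_small: "0 < \<bar>d\<bar> \<Longrightarrow> \<bar>d\<bar> < int n \<Longrightarrow> \<not> int n dvd d"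
  by (meson dvd_abs_iff zdvd_not_zless)

lemma mod_eq_imp_eq:
  assumes "i mod int n = j mod int n" "\<bar>i - j\<bar> < int n"
  shows "i = j"
  using assms not_dvd_small[of "i - j" n] unfolding mod_eq_dvd_iff by fastforce

text \<open>The period starts at an arbitrary \<open>a + 1\<close> instead of \<open>0\<close>, so
  that the cycle can later be cut open right behind an absent window \<open>a\<close>.\<close>

lemma ex_representative:
  assumes "n > 0"
  shows "\<exists>r. a < r \<and> r \<le> a + int n \<and> r mod int n = i mod int n"
proof (intro exI conjI)
  show "a < a + 1 + (i - a - 1) mod int n" "a + 1 + (i - a - 1) mod int n \<le> a + int n"
    using assms pos_mod_sign[of "int n" "i - a - 1"] pos_mod_bound[of "int n" "i - a - 1"]
    by linarith+
  show "(a + 1 + (i - a - 1) mod int n) mod int n = i mod int n"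
    by (simp add: mod_add_right_eq)
qed

text \<open>In the locale below, \<open>E\<close> and \<open>F\<close> tell which frames and windows are present;
  connectedness says that a vertex colouring that is constant along edges is constant.\<close>

locale convex_connected =
  fixes n :: nat and E F :: "int \<Rightarrow> bool"
  assumes n_pos: "n > 0"
    and E_periodic: "E (i mod int n) = E i"
    and F_periodic: "F (i mod int n) = F i"
    and E_cong: "F i \<Longrightarrow> E i = E (i + 1)"
    and not_both: "\<not> F i \<Longrightarrow> \<not> (E i \<and> E (i + 1))"
    and colouring_constant: "(\<And>i. c (i mod int n) = c i) \<Longrightarrow> (\<And>i. E i \<Longrightarrow> c i = c (i + 1)) \<Longrightarrow>
      (\<And>i. F i \<Longrightarrow> c i = c (i + 2)) \<Longrightarrow> c i = (c j :: bool)"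
begin

section \<open>Periodicity and arcs of absent frames\<close>

lemma E_mod_eq: "i mod int n = j mod int n \<Longrightarrow> E i = E j"
  using E_periodic by metis

lemma F_mod_eq: "i mod int n = j mod int n \<Longrightarrow> F i = F j"
  using F_periodic by metis

lemma F_add_period: "F (i + int n) = F i"
  by (rule F_mod_eq) simp

text \<open>For \<open>b = a + 2 * k + 1\<close> the absent edges named here are exactly those
  deleted in \<open>S_graph n k a\<close>. The case \<open>b = a + int n\<close> is included; both
  ends are then the same window.\<close>

definition arc :: "int \<Rightarrow> int \<Rightarrow> bool" where
  "arc a b \<longleftrightarrow> a < b \<and> \<not> F a \<and> \<not> F b \<and> (\<forall>i. a < i \<and> i < b \<longrightarrow> F i) \<and>
     (\<forall>i. a < i \<and> i \<le> b \<longrightarrow> \<not> E i)"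

lemma E_const:
  assumes "\<And>i. a < i \<Longrightarrow> i < b \<Longrightarrow> F i" "a < i" "i \<le> j" "j \<le> b"
  shows "E i = E j"
  using \<open>i \<le> j\<close> \<open>j \<le> b\<close>
proof (induction j rule: int_ge_induct)
  case (step j)
  have "F j" using step assms by auto
  then show ?case using E_cong[of j] step by auto
qed simp

text \<open>The arc runs from the last absent window before \<open>d\<close> to the first one from
  \<open>d\<close> on, and \<open>E_const\<close> spreads the absence of frame \<open>d\<close> over
  it. The bounds are asymmetric because frame \<open>d\<close> lies in the triangles of the windows
  \<open>d - 1\<close> and \<open>d\<close>.\<close>

lemma arc_around:
  assumes "\<not> E d" "\<not> F x" "\<not> F y" "x < d" "d \<le> y"
  shows "\<exists>a b. arc a b \<and> x \<le> a \<and> a < d \<and> d \<le> b \<and> b \<le> y"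
proof -
  define A where "A = {x..d - 1} \<inter> {i. \<not> F i}"
  define B where "B = {d..y} \<inter> {i. \<not> F i}"
  have fin: "finite A" "finite B" unfolding A_def B_def by simp_all
  have xA: "x \<in> A" and yB: "y \<in> B" using assms unfolding A_def B_def by auto
  define a where "a = Max A"
  define b where "b = Min B"
  have a: "a \<in> A" "\<And>i. i \<in> A \<Longrightarrow> i \<le> a"
    unfolding a_def using fin xA by (auto intro!: Max_in Max_ge)
  have b: "b \<in> B" "\<And>i. i \<in> B \<Longrightarrow> b \<le> i"
    unfolding b_def using fin yB by (auto intro!: Min_in Min_le)
  have ab: "x \<le> a" "a < d" "\<not> F a" "d \<le> b" "b \<le> y" "\<not> F b"
    using a(1) b(1) unfolding A_def B_def by auto
  have F: "F i" if "a < i" "i < b" for i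
  proof (rule ccontr)
    assume "\<not> F i"
    then have "i \<in> A \<or> i \<in> B" using that ab unfolding A_def B_def by auto
    then show False using a(2) b(2) that by fastforce
  qed
  have "\<not> E i" if "a < i" "i \<le> b" for i
    using E_const[of a b, OF F, of i d] E_const[of a b, OF F, of d i] that ab assms(1)
    by linarith
  then have "arc a b" unfolding arc_def using F ab by auto
  then show ?thesis using ab by blast
qed

text \<open>The cycle is cut open at the absent window \<open>a\<close>, so a colouring \<open>P\<close> has to be given on
  \<open>a + 1, \<dots>, a + n\<close> only; the value at \<open>a + n + 1\<close> accounts for the edges that wrap around.\<close>

lemma no_cut:
  fixes P :: "int \<Rightarrow> bool"
  assumes "\<not> F a"
    and PE: "\<And>i. a < i \<Longrightarrow> i \<le> a + int n \<Longrightarrow> E i \<Longrightarrow> P i = P (i + 1)"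
    and PF: "\<And>i. a < i \<Longrightarrow> i < a + int n \<Longrightarrow> F i \<Longrightarrow> P i = P (i + 2)"
    and wrap: "P (a + int n + 1) = P (a + 1)"
    and i: "a < i" "i \<le> a + int n"
  shows "P i = P (a + 1)"
proof -
  obtain rep where rep_bounds: "\<And>x. a < rep x" "\<And>x. rep x \<le> a + int n"
    and rep_mod: "\<And>x. rep x mod int n = x mod int n"
    using ex_representative[OF n_pos, of a] by metis
  have rep_unique: "rep x = y" if "x mod int n = y mod int n" "a < y" "y \<le> a + int n" for x y
    by (rule mod_eq_imp_eq[of _ n]) (use that rep_bounds[of x] rep_mod[of x] in auto)
  have rep_eq: "rep x = x" if "a < x" "x \<le> a + int n" for x
    using rep_unique that by blast
  have rep_cong: "rep x = rep y" if "x mod int n = y mod int n" for x y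
    using that rep_bounds rep_mod by (intro rep_unique) auto
  have rep_add: "rep (x + t) = rep (rep x + t)" for x t
    by (rule rep_cong) (metis rep_mod mod_add_left_eq)
  have rep_last: "rep (a + int n + 1) = a + 1"
    using n_pos by (intro rep_unique) (auto simp: mod_eq_dvd_iff)
  define c where "c x = P (rep x)" for x
  have "c i = c (a + 1)"
  proof (rule colouring_constant)
    fix x show "c (x mod int n) = c x"
      unfolding c_def using rep_cong[of "x mod int n" x] by simp
  next
    fix x assume "E x"
    then have "E (rep x)" using E_mod_eq rep_mod by blast
    then have eq: "P (rep x) = P (rep x + 1)" using PE rep_bounds by blast
    show "c x = c (x + 1)"
    proof (cases "rep x = a + int n")
      case True
      then show ?thesis unfolding c_def rep_add[of x 1] using eq wrap rep_last by simp
    next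
      case False
      then have "rep (rep x + 1) = rep x + 1" using rep_bounds[of x] by (intro rep_eq) auto
      then show ?thesis unfolding c_def rep_add[of x 1] using eq by simp
    qed
  next
    fix x assume "F x"
    then have Fr: "F (rep x)" using F_mod_eq rep_mod by blast
    \<comment> \<open>Window \<open>a + n\<close> is the absent window \<open>a\<close>, so no
      present edge starting in the period ends beyond \<open>a + n + 1\<close>; this is why a single
      wrap-around condition suffices.\<close>
    then have ne: "rep x \<noteq> a + int n" using F_add_period assms(1) by metis
    then have eq: "P (rep x) = P (rep x + 2)" using PF[of "rep x"] rep_bounds[of x] Fr by simp
    show "c x = c (x + 2)"
    proof (cases "rep x + 2 = a + int n + 1")
      case True
      then show ?thesis unfolding c_def rep_add[of x 2] by (simp only: eq True wrap rep_last)
    next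
      case False
      then have "rep (rep x + 2) = rep x + 2" using rep_bounds[of x] ne by (intro rep_eq) auto
      then show ?thesis unfolding c_def rep_add[of x 2] using eq by simp
    qed
  qed
  moreover have "rep (a + 1) = a + 1" using n_pos by (intro rep_eq) auto
  ultimately show ?thesis unfolding c_def using rep_eq[OF i] by simp
qed

section \<open>Parity and uniqueness of arcs\<close>

lemma arc_odd:
  assumes "arc a b" "b \<le> a + int n"
  shows "odd (b - a)"
proof
  assume ev: "even (b - a)"
  \<comment> \<open>These are the vertices \<open>a + 2\<close>, \<open>a + 4\<close>, ...,
    \<open>b\<close>. All their frames are absent, windows preserve parity, and the absent windows
    \<open>a\<close> and \<open>b\<close> end the chain on both sides.\<close>
  define P where "P x \<longleftrightarrow> a + 2 \<le> x \<and> x \<le> b \<and> even (x - a)" for x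
  have arc: "a < b" "\<not> F a" "\<not> F b" "\<And>i. a < i \<Longrightarrow> i \<le> b \<Longrightarrow> \<not> E i"
    using assms(1) unfolding arc_def by auto
  have b2: "a + 2 \<le> b" using ev arc(1) by presburger
  have "P (a + 2) = P (a + 1)"
  proof (rule no_cut)
    show "\<not> F a" by fact
  next
    fix i assume "a < i" "E i"
    then have "b < i" using arc(4) by force
    then show "P i = P (i + 1)" unfolding P_def by auto
  next
    fix i assume "a < i" "F i"
    then have "i \<noteq> b" using arc by auto
    then show "P i = P (i + 2)" unfolding P_def using ev \<open>a < i\<close> by presburger
  next
    show "P (a + int n + 1) = P (a + 1)" unfolding P_def using assms(2) by auto
  qed (use b2 assms in auto)
  moreover have "P (a + 2)" "\<not> P (a + 1)" unfolding P_def using b2 by auto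
  ultimately show False by blast
qed

lemma arcs_not_disjoint:
  assumes "arc a b" "arc a' b'" "b \<le> a'" "b' \<le> a + int n"
  shows False
proof -
  have arc: "a < b" "\<not> F a" "\<not> F b" "\<And>i. a < i \<Longrightarrow> i \<le> b \<Longrightarrow> \<not> E i"
    using assms(1) unfolding arc_def by auto
  have arc': "a' < b'" "\<not> F a'" "\<not> F b'" "\<And>i. a' < i \<Longrightarrow> i \<le> b' \<Longrightarrow> \<not> E i"
    using assms(2) unfolding arc_def by auto
  have odd: "odd (b - a)" by (rule arc_odd) (use assms arc' in auto)
  have odd': "odd (b' - a')" by (rule arc_odd) (use assms arc in auto)
  \<comment> \<open>One side of the separation: \<open>a + 2\<close>, \<open>a + 4\<close>, ...,
    \<open>b + 1\<close> in the first arc, everything from \<open>b + 1\<close> to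
    \<open>a' + 1\<close>, then \<open>a' + 1\<close>, \<open>a' + 3\<close>, ..., \<open>b'\<close>
    in the second. Oddness of both lengths makes the pieces fit at \<open>b + 1\<close> and lets the
    last chain stop exactly at \<open>b'\<close>.\<close>
  define P where "P x \<longleftrightarrow> a + 2 \<le> x \<and> x \<le> b + 1 \<and> even (x - a) \<or> b + 1 \<le> x \<and> x \<le> a' + 1 \<or>
    a' + 1 \<le> x \<and> x \<le> b' \<and> odd (x - a')" for x
  have P_first: "P x \<longleftrightarrow> even (x - a)" if "a < x" "x \<le> b + 1" for x
  proof (cases "x = a + 1 \<or> x = b + 1")
    case True
    then show ?thesis unfolding P_def using odd arc(1) assms(3) by auto
  next
    case False
    then show ?thesis unfolding P_def using that assms(3) by auto
  qed
  have P_between: "P x" if "b < x" "x \<le> a' + 1" for x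
    unfolding P_def using that by auto
  have P_second: "P x \<longleftrightarrow> odd (x - a')" if "a' < x" "x \<le> b' + 1" for x
  proof (cases "x = a' + 1 \<or> x = b' + 1")
    case True
    then show ?thesis unfolding P_def using odd' arc'(1) assms(3) by auto
  next
    case False
    then show ?thesis unfolding P_def using that assms(3) by auto
  qed
  have P_after: "\<not> P x" if "b' < x" for x
    unfolding P_def using that arc'(1) assms(3) by auto
  have "P (b + 1) = P (a + 1)"
  proof (rule no_cut)
    show "\<not> F a" by fact
  next
    fix i assume i: "a < i" "E i"
    then consider "b < i" "i \<le> a'" | "b' < i" using arc(4)[of i] arc'(4)[of i] by force
    then show "P i = P (i + 1)" by cases (simp_all add: P_between P_after)
  next
    fix i assume i: "a < i" "F i"
    then have "i \<noteq> b" "i \<noteq> a'" "i \<noteq> b'" using arc arc' by auto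
    \<comment> \<open>A present window starting before an end of an arc reaches at most one vertex
      past that end, hence stays in the range of a single one of the four descriptions of
      \<open>P\<close>.\<close>
    then consider "i < b" | "b < i" "i < a'" | "a' < i" "i < b'" | "b' < i" by linarith
    then show "P i = P (i + 2)"
      by cases (use i in \<open>simp_all add: P_first P_between P_second P_after\<close>)
  next
    have "b' < a + int n + 1" using assms(4) by simp
    then show "P (a + int n + 1) = P (a + 1)"
      using P_after P_first[of "a + 1"] arc(1) by simp
  qed (use assms arc arc' in auto)
  moreover have "P (b + 1)" "\<not> P (a + 1)"
    using P_between[of "b + 1"] P_first[of "a + 1"] assms(3) arc(1) by auto
  ultimately show False by blast
qed

text \<open>An absent frame here would lie between the absent windows \<open>b\<close> and
  \<open>a + n\<close>, hence in a second arc disjoint from the first. A window whose two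
  neighbouring frames are present is then present by \<open>not_both\<close>.\<close>

lemma present_outside_arc:
  assumes "arc a b" "b \<le> a + int n"
  shows "b < i \<Longrightarrow> i \<le> a + int n \<Longrightarrow> E i" and "b < i \<Longrightarrow> i < a + int n \<Longrightarrow> F i"
proof -
  have nF: "\<not> F b" "\<not> F (a + int n)" using assms(1) F_add_period unfolding arc_def by auto
  show E: "E i" if "b < i" "i \<le> a + int n" for i
  proof (rule ccontr)
    assume "\<not> E i"
    from arc_around[OF this nF that] obtain a' b' where "arc a' b'" "b \<le> a'" "b' \<le> a + int n"
      by blast
    then show False using arcs_not_disjoint assms(1) by blast
  qed
  show "F i" if "b < i" "i < a + int n"
    using not_both[of i] E[of i] E[of "i + 1"] that by auto
qed

section \<open>Classification over one period\<close>

lemma arc_shift: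
  assumes "arc a b"
  shows "arc (a + int n * t) (b + int n * t)"
proof -
  have E: "E (i + int n * t) = E i" for i by (rule E_mod_eq) simp
  have F: "F (i + int n * t) = F i" for i by (rule F_mod_eq) simp
  have "F i" if "a + int n * t < i" "i < b + int n * t" for i
    using F[of "i - int n * t"] assms that unfolding arc_def by auto
  moreover have "\<not> E i" if "a + int n * t < i" "i \<le> b + int n * t" for i
    using E[of "i - int n * t"] assms that unfolding arc_def by auto
  ultimately show ?thesis using assms F unfolding arc_def by auto
qed

text \<open>Without an absent window all frames agree. If they are all absent and \<open>n\<close>
  is even, parity is a nonconstant colouring preserved by every window.\<close>

lemma all_windows:
  assumes "\<And>i. F i"
  shows "(\<forall>i. E i) \<or> odd n \<and> (\<forall>i. \<not> E i)"
proof (cases "\<forall>i. E i")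
  case False
  then obtain d where "\<not> E d" by blast
  have none: "\<not> E i" for i
    using E_const[of "min i d - 1" "max i d" i d] E_const[of "min i d - 1" "max i d" d i]
      \<open>\<not> E d\<close> assms by (cases "i \<le> d") auto
  have "odd n"
  proof
    assume "even n"
    then have "even (i mod int n) = even i" for i :: int
      by (simp add: dvd_mod_iff)
    then have "even (0 :: int) = even (1 :: int)"
      by (rule colouring_constant) (use none in auto)
    then show False by simp
  qed
  with none show ?thesis by blast
qed auto

text \<open>The pattern is read off on \<open>a + 1\<close>, ..., \<open>a + n\<close>, where
  indices can be compared as integers; window \<open>a\<close> therefore appears as
  \<open>a + int n\<close>.\<close>

lemma classification:
  assumes "\<not> ((\<forall>i. E i) \<and> (\<forall>i. F i))" "\<not> (odd n \<and> (\<forall>i. \<not> E i) \<and> (\<forall>i. F i))"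
  shows "\<exists>a k. 0 \<le> a \<and> a < int n \<and> 0 \<le> k \<and> 2 * k + 1 \<le> int n \<and>
    (\<forall>i. a < i \<and> i \<le> a + int n \<longrightarrow>
      (E i \<longleftrightarrow> a + 2 * k + 1 < i) \<and> (F i \<longleftrightarrow> i \<noteq> a + 2 * k + 1 \<and> i \<noteq> a + int n))"
proof -
  obtain x where x: "\<not> F x" using all_windows assms by blast
  \<comment> \<open>An absent window leaves frame \<open>x\<close> or frame \<open>x + 1\<close>
    absent; in the former case \<open>x + n\<close> is taken to get an index beyond
    \<open>x\<close>.\<close>
  then obtain d where d: "\<not> E d" "x < d" "d \<le> x + int n"
  proof (cases "E (x + 1)")
    case True
    then have "\<not> E x" using not_both[OF x] by blast
    then have "\<not> E (x + int n)" using E_mod_eq[of "x + int n" x] by simp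
    then show ?thesis using that[of "x + int n"] n_pos by simp
  next
    case False
    then show ?thesis using that[of "x + 1"] n_pos by simp
  qed
  have "\<not> F (x + int n)" using x F_add_period by blast
  from arc_around[OF d(1) x this d(2,3)] obtain a0 b0
    where "arc a0 b0" "x \<le> a0" "b0 \<le> x + int n" by blast
  \<comment> \<open>Both ends are moved by the same multiple of \<open>n\<close> so that the left
    one falls into \<open>0\<close>, ..., \<open>n - 1\<close>.\<close>
  define a where "a = a0 mod int n"
  define b where "b = b0 - int n * (a0 div int n)"
  have a_eq: "a = a0 - int n * (a0 div int n)"
    unfolding a_def by (simp add: minus_mult_div_eq_mod)
  have arc: "arc a b" using arc_shift[OF \<open>arc a0 b0\<close>, of "- (a0 div int n)"]
    unfolding a_eq b_def by simp
  have ba: "b \<le> a + int n" using \<open>x \<le> a0\<close> \<open>b0 \<le> x + int n\<close> unfolding a_eq b_def by simp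
  define k where "k = (b - a) div 2"
  have b: "b = a + 2 * k + 1" using arc_odd[OF arc ba] unfolding k_def by presburger
  have k: "0 \<le> k" using arc unfolding arc_def k_def by simp
  have a: "0 \<le> a" "a < int n" unfolding a_def using n_pos by auto
  have "\<not> F (a + int n)" using arc F_add_period unfolding arc_def by blast
  then have "(E i \<longleftrightarrow> b < i) \<and> (F i \<longleftrightarrow> i \<noteq> b \<and> i \<noteq> a + int n)"
    if "a < i" "i \<le> a + int n" for i
    using present_outside_arc[OF arc ba, of i] arc that ba unfolding arc_def
    by (cases i b rule: linorder_cases) (auto simp: not_less)
  then show ?thesis using a k ba unfolding b by (intro exI[of _ a] exI[of _ k]) simp
qed

end

section \<open>Frames and windows as edges; entry into the locale\<close>

lemma vtx_eq_iff: "vtx n i = vtx n j \<longleftrightarrow> int n dvd i - j"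
  unfolding vtx_def by (rule mod_eq_dvd_iff)

text \<open>Rules out accidental coincidences of edges: each would require two divisibilities whose
  difference is 1, 2, 3 or 4, impossible for \<open>n \<ge> 5\<close>.\<close>

lemma dvd_sum_small:
  assumes "int n dvd x" "int n dvd y" "x + y = d \<or> x - y = d" "0 < \<bar>d\<bar>" "\<bar>d\<bar> < int n"
  shows False
  using assms not_dvd_small dvd_add dvd_diff by metis

lemma frame_eq_iff:
  assumes "n \<ge> 5"
  shows "frame n i = frame n j \<longleftrightarrow> i mod int n = j mod int n"
proof -
  have "\<not> (int n dvd i - (j + 1) \<and> int n dvd (i + 1) - j)"
    using dvd_sum_small[of n "i + 1 - j" "i - (j + 1)" 2] assms by auto
  then show ?thesis
    unfolding frame_def doubleton_eq_iff vtx_eq_iff mod_eq_dvd_iff by auto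
qed

lemma window_eq_iff:
  assumes "n \<ge> 5"
  shows "window n i = window n j \<longleftrightarrow> i mod int n = j mod int n"
proof -
  have "\<not> (int n dvd i - (j + 2) \<and> int n dvd (i + 2) - j)"
    using dvd_sum_small[of n "i + 2 - j" "i - (j + 2)" 4] assms by auto
  then show ?thesis
    unfolding window_def doubleton_eq_iff vtx_eq_iff mod_eq_dvd_iff by auto
qed

lemma frame_neq_window:
  assumes "n \<ge> 5"
  shows "frame n i \<noteq> window n j"
proof -
  have "\<not> (int n dvd i - j \<and> int n dvd (i + 1) - (j + 2))"
    using dvd_sum_small[of n "i - j" "i + 1 - (j + 2)" 1] assms by auto
  moreover have "\<not> (int n dvd i - (j + 2) \<and> int n dvd (i + 1) - j)"
    using dvd_sum_small[of n "i + 1 - j" "i - (j + 2)" 3] assms by auto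
  ultimately show ?thesis
    unfolding frame_def window_def doubleton_eq_iff vtx_eq_iff by auto
qed

lemma edges_square_cycle: "edges (square_cycle n) = range (frame n) \<union> range (window n)"
proof -
  have "{{vtx n i, vtx n j} | i j. i - j \<in> {1, 2}} =
    {{vtx n j, vtx n (j + 1)} | j. True} \<union> {{vtx n j, vtx n (j + 2)} | j. True}"
  proof (intro equalityI subsetI)
    fix e assume "e \<in> {{vtx n i, vtx n j} | i j. i - j \<in> {1, 2}}"
    then obtain i j where "e = {vtx n i, vtx n j}" "i = j + 1 \<or> i = j + 2"
      by (auto simp: algebra_simps)
    then show "e \<in> {{vtx n j, vtx n (j + 1)} | j. True} \<union> {{vtx n j, vtx n (j + 2)} | j. True}"
      by (auto simp: insert_commute)
  next
    fix e assume "e \<in> {{vtx n j, vtx n (j + 1)} | j. True} \<union> {{vtx n j, vtx n (j + 2)} | j. True}"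
    then obtain j t where "e = {vtx n (j + t), vtx n j}" "t = 1 \<or> t = 2"
      by (auto simp: insert_commute)
    then show "e \<in> {{vtx n i, vtx n j} | i j. i - j \<in> {1, 2}}"
      by (intro CollectI exI[of _ "j + t"] exI[of _ j]) auto
  qed
  then show ?thesis unfolding square_cycle_def frame_def window_def by auto
qed

lemma edge_set_eqI:
  assumes "A \<subseteq> edges (square_cycle n)" "B \<subseteq> edges (square_cycle n)"
    and "\<And>i. frame n i \<in> A \<longleftrightarrow> frame n i \<in> B" "\<And>i. window n i \<in> A \<longleftrightarrow> window n i \<in> B"
  shows "A = B"
  using assms unfolding edges_square_cycle by blast

text \<open>The colour is carried along a path from \<open>vtx n i\<close> to
  \<open>vtx n j\<close>. Edges are unordered, so each step may traverse a frame or window in either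
  direction.\<close>

lemma colouring_constant_if_connected:
  fixes c :: "int \<Rightarrow> bool"
  assumes "spanning_subgraph G (square_cycle n)" "connected_graph G"
    and c: "\<And>i. c (i mod int n) = c i"
    and cE: "\<And>i. frame n i \<in> edges G \<Longrightarrow> c i = c (i + 1)"
    and cF: "\<And>i. window n i \<in> edges G \<Longrightarrow> c i = c (i + 2)"
  shows "c i = c j"
proof -
  have V: "vertices G = range (vtx n)" and sub: "edges G \<subseteq> edges (square_cycle n)"
    using assms(1) unfolding spanning_subgraph_def subgraph_def square_cycle_def by auto
  have cv: "c (vtx n i) = c i" for i unfolding vtx_def by (rule c)
  have step: "c x = c y" if "{x, y} \<in> edges G" for x y
  proof -
    from sub that consider i where "{x, y} = frame n i" | i where "{x, y} = window n i"
      unfolding edges_square_cycle by blast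
    then show ?thesis
    proof cases
      case (1 i)
      then have "c i = c (i + 1)" using cE that by simp
      then show ?thesis using 1 cv[of i] cv[of "i + 1"]
        unfolding frame_def doubleton_eq_iff by metis
    next
      case (2 i)
      then have "c i = c (i + 2)" using cF that by simp
      then show ?thesis using 2 cv[of i] cv[of "i + 2"]
        unfolding window_def doubleton_eq_iff by metis
    qed
  qed
  have "(vtx n i, vtx n j) \<in> {(x, y). {x, y} \<in> edges G}\<^sup>*"
    using assms(2) V unfolding connected_graph_def by blast
  then have "c (vtx n i) = c (vtx n j)"
    by (induction rule: rtrancl_induct) (use step in auto)
  then show ?thesis using cv by simp
qed

lemma convex_triangle:
  assumes "convex_subgraph n G"
    and "x \<in> triangle n i \<inter> edges G" "y \<in> triangle n i \<inter> edges G" "x \<noteq> y"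
  shows "triangle n i \<subseteq> edges G"
proof -
  have "finite (triangle n i \<inter> edges G)" unfolding triangle_def by simp
  then have "card {x, y} \<le> card (triangle n i \<inter> edges G)"
    using assms by (intro card_mono) auto
  then have "\<not> card (triangle n i \<inter> edges G) \<le> 1" using assms(4) by simp
  then show ?thesis using assms(1) unfolding convex_subgraph_def by blast
qed

text \<open>\<open>E_cong\<close> and \<open>not_both\<close> say that two present edges of a
  triangle force the third. Applying \<open>convex_triangle\<close> requires the three edges to be
  distinct, which comes from \<open>n \<ge> 5\<close>.\<close>

lemma convex_connected_square_cycle:
  assumes n: "n \<ge> 5" and "spanning_subgraph G (square_cycle n)" "connected_graph G"
    and cv: "convex_subgraph n G"
  shows "convex_connected n (\<lambda>i. frame n i \<in> edges G) (\<lambda>i. window n i \<in> edges G)"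
proof
  fix i
  have "\<not> int n dvd i - (i + 1)"
    using not_dvd_small[of "i - (i + 1)" n] n by auto
  then have ne: "frame n i \<noteq> frame n (i + 1)"
    using frame_eq_iff[OF n] mod_eq_dvd_iff by metis
  note tri = convex_triangle[OF cv, of _ i, unfolded triangle_def]
  have ne': "frame n j \<noteq> window n i" for j using frame_neq_window[OF n] .
  show "(frame n i \<in> edges G) = (frame n (i + 1) \<in> edges G)" if "window n i \<in> edges G"
    using tri[of "window n i" "frame n i"] tri[of "window n i" "frame n (i + 1)"] that
      ne'[of i] ne'[of "i + 1"] by auto
  show "\<not> (frame n i \<in> edges G \<and> frame n (i + 1) \<in> edges G)" if "window n i \<notin> edges G"
    using tri[of "frame n i" "frame n (i + 1)"] that ne by auto
  show "(frame n (i mod int n) \<in> edges G) = (frame n i \<in> edges G)"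
    using frame_eq_iff[OF n, of "i mod int n" i] by simp
  show "(window n (i mod int n) \<in> edges G) = (window n i \<in> edges G)"
    using window_eq_iff[OF n, of "i mod int n" i] by simp
qed (use n colouring_constant_if_connected[OF assms(2,3)] in auto)

section \<open>Transfer of the classification to graphs\<close>

theorem theorem3p4:
  fixes n :: nat and G :: "int ugraph"
  assumes "n \<ge> 5"
    and "spanning_subgraph G (square_cycle n)"
    and "connected_graph G"
    and "convex_subgraph n G"
    and "nontrivial n G"
  shows "\<exists>j k :: int. 0 \<le> j \<and> j \<le> int n - 1 \<and>
           0 \<le> k \<and> k \<le> \<lceil>(real n - 2) / 2\<rceil> \<and> G = S_graph n k j"
proof -
  note n = \<open>n \<ge> 5\<close>
  interpret convex_connected n "\<lambda>i. frame n i \<in> edges G" "\<lambda>i. window n i \<in> edges G"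
    using assms by (intro convex_connected_square_cycle)
  have V: "vertices G = range (vtx n)" and sub: "edges G \<subseteq> edges (square_cycle n)"
    using assms(2) unfolding spanning_subgraph_def subgraph_def square_cycle_def by auto
  have windows: "window n ` {0..int n - 1} = range (window n)"
  proof (intro equalityI subsetI)
    fix w assume "w \<in> range (window n)"
    then obtain i where "w = window n i" by blast
    then have "w = window n (i mod int n)" using window_eq_iff[OF n] by simp
    then show "w \<in> window n ` {0..int n - 1}" using n by auto
  qed auto
  have "\<not> ((\<forall>i. frame n i \<in> edges G) \<and> (\<forall>i. window n i \<in> edges G))"
  proof
    assume "(\<forall>i. frame n i \<in> edges G) \<and> (\<forall>i. window n i \<in> edges G)"
    then have "edges G = edges (square_cycle n)" using sub unfolding edges_square_cycle by blast
    then have "G = square_cycle n" using V by (simp add: square_cycle_def)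
    then show False using assms(5) unfolding nontrivial_def by blast
  qed
  moreover have "\<not> (odd n \<and> (\<forall>i. frame n i \<notin> edges G) \<and> (\<forall>i. window n i \<in> edges G))"
  proof
    assume *: "odd n \<and> (\<forall>i. frame n i \<notin> edges G) \<and> (\<forall>i. window n i \<in> edges G)"
    then have "edges G = range (window n)" using sub unfolding edges_square_cycle by blast
    then have "G = window_graph n" using V windows by (simp add: window_graph_def)
    then show False using assms(5) * unfolding nontrivial_def by blast
  qed
  ultimately obtain a k where a: "0 \<le> a" "a < int n" and k: "0 \<le> k" "2 * k + 1 \<le> int n"
    and E: "\<And>i. a < i \<Longrightarrow> i \<le> a + int n \<Longrightarrow> frame n i \<in> edges G \<longleftrightarrow> a + 2 * k + 1 < i"
    and F: "\<And>i. a < i \<Longrightarrow> i \<le> a + int n \<Longrightarrow>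
      window n i \<in> edges G \<longleftrightarrow> i \<noteq> a + 2 * k + 1 \<and> i \<noteq> a + int n"
    using classification by blast
  define D where "D = {window n a, window n (a + 2 * k + 1)} \<union> frame n ` {a + 1 .. a + 2 * k + 1}"
  have "edges G = edges (square_cycle n) - D"
  proof (rule edge_set_eqI[where n = n])
    fix i
    \<comment> \<open>The equivalences \<open>E\<close> and \<open>F\<close> hold only on the period
      behind \<open>a\<close>, so the edge is renamed by its representative there.\<close>
    obtain r where r: "a < r" "r \<le> a + int n" "r mod int n = i mod int n"
      using ex_representative[OF n_pos, of a i] by blast
    have fr: "frame n i = frame n r" and wr: "window n i = window n r"
      using r(3) frame_eq_iff[OF n] window_eq_iff[OF n] by metis+
    have "frame n r \<in> D \<longleftrightarrow> r \<in> {a + 1 .. a + 2 * k + 1}"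
    proof
      assume "frame n r \<in> D"
      then obtain j where j: "j \<in> {a + 1 .. a + 2 * k + 1}" "frame n r = frame n j"
        unfolding D_def using frame_neq_window[OF n] by blast
      then have "r mod int n = j mod int n" using frame_eq_iff[OF n] by simp
      \<comment> \<open>Since \<open>2 * k + 1 \<le> int n\<close>, the deleted frames have indices
        in the same period as \<open>r\<close>.\<close>
      then have "r = j" by (rule mod_eq_imp_eq) (use j(1) r k in auto)
      then show "r \<in> {a + 1 .. a + 2 * k + 1}" using j by simp
    qed (auto simp: D_def)
    then show "frame n i \<in> edges G \<longleftrightarrow> frame n i \<in> edges (square_cycle n) - D"
      unfolding fr edges_square_cycle using E[OF r(1,2)] r(1) by auto
    have "window n r = window n a \<longleftrightarrow> r = a + int n"
      using window_eq_iff[OF n, of r a] mod_eq_imp_eq[of r n "a + int n"] r by auto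
    moreover have "window n r = window n (a + 2 * k + 1) \<longleftrightarrow> r = a + 2 * k + 1"
      using window_eq_iff[OF n, of r "a + 2 * k + 1"] mod_eq_imp_eq[of r n "a + 2 * k + 1"] r k
      by auto
    ultimately have "window n r \<in> D \<longleftrightarrow> r = a + int n \<or> r = a + 2 * k + 1"
      unfolding D_def using frame_neq_window[OF n] by blast
    then show "window n i \<in> edges G \<longleftrightarrow> window n i \<in> edges (square_cycle n) - D"
      unfolding wr edges_square_cycle using F[OF r(1,2)] by auto
  qed (use sub in auto)
  then have "G = S_graph n k a" unfolding S_graph_def D_def using V by simp
  moreover have "k \<le> \<lceil>(real n - 2) / 2\<rceil>"
  proof -
    \<comment> \<open>The ceiling bound unfolds to \<open>k - 1 < (n - 2) / 2\<close>, that is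
      \<open>2 * k < n\<close>.\<close>
    have "real_of_int (2 * k + 1) \<le> real_of_int (int n)"
      using k(2) by (rule of_int_le_iff[THEN iffD2])
    then show ?thesis unfolding le_ceiling_iff by simp
  qed
  ultimately show ?thesis using a k(1) by (intro exI[of _ a] exI[of _ k]) auto
qed

end
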